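(* Let system $\mathcal{S}_a$ have contracting dynamics, i.e. there are a compact set $\mathcal A\subset\mathbb R^n$, a function $\beta\in\mathcal{KL}$ and a constant $c>0$ with $$\|\mathbf x(t)\|_{\mathcal A}\le\beta(\|\mathbf x(t_0)\|_{\mathcal A},t-t_0)+c\,\|u_a\|_{\infty,[t_0,t]}\quad\text{for all } t_0\in\mathbb R_+,\ t\ge t_0,$$ and let system $\mathcal{S}_w$ have wandering dynamics, i.e. $\mathcal S_w$ is forward-complete ($u_w\in\mathcal U_w$ implies $\mathbf z\in\mathcal Z$ for all $t\ge t_0$, $t_0\in\mathbb R_+$) and there are an output function $h:\mathbb R^m\to\mathbb R$ and functions $\gamma_0,\gamma_1\in\mathcal K_{\infty,e}$ with $$\int_{t_0}^t\gamma_1(u_w(\tau))\,d\tau\le h(\mathbf z(t_0))-h(\mathbf z(t))\le\int_{t_0}^t\gamma_0(u_w(\tau))\,d\tau\quad\text{for all } t_0\in\mathbb R_+,\ t\ge t_0,$$ where, moreover, for any $M\in\mathbb R_+$ there are functions $\gamma_{0,1},\gamma_{0,2}:\mathbb R_+\to\mathbb R_+$ with $\gamma_0(ab)\le\gamma_{0,1}(a)\gamma_{0,2}(b)$ for all $a,b\in[0,M]$. Consider their interconnection with $u_a(t)=h(\mathbf z(t))$, $u_w(t)=\|\mathbf x(t)\|_{\mathcal A}$, i.e. $$\|\mathbf x(t)\|_{\mathcal A}\le \beta(\|\mathbf x(t_0)\|_{\mathcal A},t-t_0)+c\,\|h(\mathbf z(\cdot))\|_{\infty,[t_0,t]},$$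 $$\int_{t_0}^{t}\gamma_1(\|\mathbf x(\tau)\|_{\mathcal A})\,d\tau\le h(\mathbf z(t_0))-h(\mathbf z(t))\le\int_{t_0}^{t}\gamma_0(\|\mathbf x(\tau)\|_{\mathcal A})\,d\tau .$$ Suppose there exist sequences $\mathcal S=\{\sigma_i\}_{i=0}^\infty$, $\Xi=\{\xi_i\}_{i=0}^\infty$, $\mathcal T=\{\tau_i\}_{i=0}^\infty$ satisfying Conditions (P1), (P2), (P3) of the context, with $B_1,B_2$ the bounding functions in (P3), and suppose: 1) there exists $\Delta_0>0$ such that $\frac{1}{\tau_i}\frac{\sigma_i-\sigma_{i+1}}{\gamma_{0,1}(\sigma_i)}\ge\Delta_0$ for all $i=0,1,2,\dots$; 2) the set $\Omega_\gamma$ of all $(\mathbf x_0,\mathbf z_0)$ with $\gamma_{0,2}\big(B_1(\|\mathbf x_0\|_{\mathcal A})+B_2(|h(\mathbf z_0)|,c)+c|h(\mathbf z_0)|\big)\le h(\mathbf z_0)\Delta_0$ is not empty; 3) $\sum_{i=0}^\infty\tau_i=\infty$. Let, in addition, C1) the flow $(\mathbf x(t,\mathbf x_0),\mathbf z(t,\mathbf z_0))$ be generated by a system of autonomous differential equations with locally Lipschitz right-hand side; C2) subsystem $\mathcal S_w$ be practically integral-input-to-state stable: $$\|\mathbf z(\tau)\|_{\infty,[t_0,t]}\le C_z+\int_{t_0}^t\gamma_1(u_w(\tau))\,d\tau$$ for some constant $C_z$, and let the function $h$ be continuous; C3) system $\mathcal S_a$ have steady-state characteristic $\chi$ with respect to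 $\|\mathbf x\|_{\mathcal A}$. Then for all $(\mathbf x_0,\mathbf z_0)\in\Omega_\gamma$ the state of the interconnection started at $\mathbf x(t_0)=\mathbf x_0$, $\mathbf z(t_0)=\mathbf z_0$ converges as $t\to\infty$ to the set $$\Omega_a=\{(\mathbf x,\mathbf z)\ :\ \|\mathbf x\|_{\mathcal A}=0,\ \ h(\mathbf z)\in\chi^{-1}(0)\},$$ where $\chi^{-1}(0)=\{\bar u_a\in\mathbb R_+:\ 0\in\chi(\bar u_a)\}$.
   Context: Notation. $\mathbb R_+=[0,\infty)$. $\mathcal S\{\Omega\}$ is the set of all subsets of $\Omega$. $\mathcal K$ is the class of strictly increasing functions $\kappa:\mathbb R_+\to\mathbb R_+$ with $\kappa(0)=0$; $\mathcal K_\infty$ those with in addition $\kappa(s)\to\infty$; $\mathcal K_{\infty,e}$ is the class of functions whose restriction to $[0,\infty)$ is in $\mathcal K_\infty$. $\mathcal{KL}$ is the class of $\beta:\mathbb R_+\times\mathbb R_+\to\mathbb R_+$ with $\beta(\cdot,0)\in\mathcal K$ and, for each $s$, $\beta(s,\cdot)$ monotonically decreasing to $0$. $\|\mathbf x\|_{\mathcal A}=\inf_{\mathbf q\in\mathcal A}\|\mathbf x-\mathbf q\|$ (Euclidean norm); $\|f\|_{\infty,[t_0,t]}=\sup_{\tau\in[t_0,t]}\|f(\tau)\|$. Systems. $\mathcal S_a:(u_a,\mathbf x_0)\mapsto\mathbf x(t)\in\mathbb R^n$ and $\mathcal S_w:(u_w,\mathbf z_0)\mapsto\mathbf z(t)\in\mathbb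 R^m$, with scalar inputs $u_a\in\mathcal U_a\subseteq L_\infty[t_0,\infty]$, $u_w\in\mathcal U_w\subseteq L_\infty[t_0,\infty]$, initial conditions $\mathbf x_0\in\mathbb R^n$, $\mathbf z_0\in\mathbb R^m$, and state trajectories in $\mathcal X\subseteq L^n_\infty[t_0,\infty]$, $\mathcal Z\subseteq L^m_\infty[t_0,\infty]$. Contracting dynamics: there are a compact set $\mathcal A\subset\mathbb R^n$, $\beta\in\mathcal{KL}$ and $c>0$ with $\|\mathbf x(t)\|_{\mathcal A}\le\beta(\|\mathbf x(t_0)\|_{\mathcal A},t-t_0)+c\|u_a\|_{\infty,[t_0,t]}$ for all $t_0\in\mathbb R_+$, $t\ge t_0$ (any time may serve as starting time). Wandering dynamics: $\mathcal S_w$ is forward-complete ($u_w\in\mathcal U_w$ implies $\mathbf z\in\mathcal Z$ for all $t\ge t_0$, $t_0\in\mathbb R_+$) and there are an output function $h:\mathbb R^m\to\mathbb R$ and $\gamma_0,\gamma_1\in\mathcal K_{\infty,e}$ with $\int_{t_0}^t\gamma_1(u_w(\tau))d\tau\le h(\mathbf z(t_0))-h(\mathbf z(t))\le\int_{t_0}^t\gamma_0(u_w(\tau))d\tau$ for all $t_0\in\mathbb R_+$, $t\ge t_0$. Moreover, for any $M\in\mathbb R_+$ there are functions $\gamma_{0,1},\gamma_{0,2}:\mathbb R_+\to\mathbb R_+$ with $\gamma_0(ab)\le\gamma_{0,1}(a)\gamma_{0,2}(b)$ for all $a,b\in[0,M]$. The functions $\gamma_{0,1},\gamma_{0,2}$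 in the claim are such functions, for an $M$ large enough that the arguments at which they are evaluated in the claim lie in $[0,M]$. Conditions on the sequences ($\sigma_i$ real, $\xi_i\in\mathbb R_+$, $\tau_i>0$): (P1) $\{\sigma_n\}$ is strictly monotone, $\sigma_0=1$, $\lim_{n\to\infty}\sigma_n=0$. (P2) For every $i$: $\beta(s,T)\le\xi_i\,\beta(s,0)$ for all $s\in\mathbb R_+$ and all $T\ge\tau_i$. (P3) For each $i\ge0$ define functions $\phi_j=\phi_j^{(i)}$, $\upsilon_j=\upsilon_j^{(i)}$, $j=0,\dots,i$, by $\phi_0(s)=\beta(s,0)$, $\phi_j(s)=\phi_{j-1}\big(\rho_{\phi,j}(\xi_{i-j}\cdot\beta(s,0))\big)$ for $j=1,\dots,i$, and $\upsilon_0(s)=\beta(s,0)$, $\upsilon_j(s)=\phi_{j-1}(\rho_{\upsilon,j}(s))$ for $j=1,\dots,i$, where $\rho_{\phi,j},\rho_{\upsilon,j}\in\mathcal K$ satisfy $\phi_{j-1}(a+b)\le\phi_{j-1}(\rho_{\phi,j}(a))+\phi_{j-1}(\rho_{\upsilon,j}(b))$ for all $a,b\ge0$. Condition (P3) requires that there exist functions $B_1(\cdot)$, $B_2(\cdot,\cdot)$ such that for all $n=0,1,2,\dots$: $\sigma_n^{-1}\phi^{(n)}_n(\|\mathbf x_0\|_{\mathcal A})\le B_1(\|\mathbf x_0\|_{\mathcal A})$ and $\sigma_n^{-1}\sum_{i=0}^n\upsilon^{(n)}_i\big(c|h(\mathbf z_0)|\sigma_{n-i}\big)\le B_2(|h(\mathbf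 z_0)|,c)$. Steady-state characteristic: $\mathcal S_a$ has steady-state characteristic $\chi:\mathbb R\to\mathcal S\{\mathbb R_+\}$ with respect to $\|\mathbf x\|_{\mathcal A}$ iff for each constant $\bar u_a$ and every $u_a\in\mathcal U_a$ with $\lim_{t\to\infty}u_a(t)=\bar u_a$, the limit $\lim_{t\to\infty}\|\mathbf x(t)\|_{\mathcal A}$ exists and belongs to $\chi(\bar u_a)$. "Converges to $\Omega_a$" means that the distance of the state to $\Omega_a$ tends to $0$ as $t\to\infty$. *)

theory Defs
  imports "HOL-Analysis.Analysis"
begin

text \<open>Comparison functions. Functions with domain \<open>[0,\<infinity>)\<close> are represented by functions on \<open>real\<close>
  whose values at negative arguments are irrelevant. No continuity is required.\<close>

definition K_class :: "(real \<Rightarrow> real) set" where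
  "K_class = {\<kappa>. strict_mono_on {0..} \<kappa> \<and> \<kappa> 0 = 0}"

definition K_inf_class :: "(real \<Rightarrow> real) set" where
  "K_inf_class = {\<kappa> \<in> K_class. filterlim \<kappa> at_top at_top}"

text \<open>Functions on the whole real line whose restriction to \<open>[0,\<infinity>)\<close> is of class \<open>K_inf_class\<close>. As the
  latter constrains only values on \<open>[0,\<infinity>)\<close>, the two sets coincide; the distinct name marks
  functions whose values at negative arguments are meaningful.\<close>

definition K_inf_e_class :: "(real \<Rightarrow> real) set" where
  "K_inf_e_class = K_inf_class"

definition KL_class :: "(real \<Rightarrow> real \<Rightarrow> real) set" where
  "KL_class = {\<beta>. (\<forall>s\<ge>0. \<forall>t\<ge>0. 0 \<le> \<beta> s t) \<and> (\<lambda>s. \<beta> s 0) \<in> K_class \<and>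
     (\<forall>s\<ge>0. antimono_on {0..} (\<beta> s) \<and> ((\<beta> s) \<longlongrightarrow> 0) at_top)}"

definition sup_norm :: "(real \<Rightarrow> 'a::real_normed_vector) \<Rightarrow> real \<Rightarrow> real \<Rightarrow> real" where
  "sup_norm f t0 t = (SUP \<tau>\<in>{t0..t}. norm (f \<tau>))"

text \<open>Finiteness of the supremum norm on \<open>[t0,\<infinity>)\<close>; values before \<open>t0\<close> are irrelevant.\<close>

definition L_inf :: "real \<Rightarrow> (real \<Rightarrow> 'a::real_normed_vector) set" where
  "L_inf t0 = {f. bounded (f ` {t0..})}"

text \<open>A system is a map \<open>S\<close>, where \<open>S t0 u x0\<close> is the state trajectory on \<open>[t0,\<infinity>)\<close> produced by the
  input \<open>u\<close> from the state \<open>x0\<close> at time \<open>t0\<close>. Inputs admissible from time \<open>t0\<close> on form the set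
  \<open>U t0\<close>; \<open>X t0\<close> is the space of state trajectories.\<close>

type_synonym 'x system = "real \<Rightarrow> (real \<Rightarrow> real) \<Rightarrow> 'x \<Rightarrow> real \<Rightarrow> 'x"

definition io_system ::
  "(real \<Rightarrow> (real \<Rightarrow> real) set) \<Rightarrow> (real \<Rightarrow> (real \<Rightarrow> 'x::real_normed_vector) set) \<Rightarrow> 'x system \<Rightarrow> bool" where
  "io_system U X S \<longleftrightarrow>
     (\<forall>t0\<ge>0. U t0 \<subseteq> L_inf t0 \<and> X t0 \<subseteq> L_inf t0 \<and>
        (\<forall>u\<in>U t0. \<forall>x0. S t0 u x0 t0 = x0))"

definition forward_complete ::
  "(real \<Rightarrow> (real \<Rightarrow> real) set) \<Rightarrow> (real \<Rightarrow> (real \<Rightarrow> 'x) set) \<Rightarrow> 'x system \<Rightarrow> bool" where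
  "forward_complete U X S \<longleftrightarrow> (\<forall>t0\<ge>0. \<forall>u\<in>U t0. \<forall>x0. S t0 u x0 \<in> X t0)"

text \<open>In the next two definitions \<open>s\<close> is the time at which the trajectory is started. The estimates
  hold from every later time \<open>t0\<close> of the trajectory. The distance to \<open>A\<close> is \<open>infdist\<close>; nonemptiness
  of \<open>A\<close> is needed since \<open>infdist x {} = 0\<close>.\<close>

definition contracting_dynamics ::
  "(real \<Rightarrow> (real \<Rightarrow> real) set) \<Rightarrow> 'x::metric_space system \<Rightarrow> 'x set \<Rightarrow>
     (real \<Rightarrow> real \<Rightarrow> real) \<Rightarrow> real \<Rightarrow> bool" where
  "contracting_dynamics U S A \<beta> c \<longleftrightarrow>
     compact A \<and> A \<noteq> {} \<and> \<beta> \<in> KL_class \<and> c > 0 \<and>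
     (\<forall>s\<ge>0. \<forall>u\<in>U s. \<forall>x0. \<forall>t0\<ge>s. \<forall>t\<ge>t0.
        infdist (S s u x0 t) A \<le> \<beta> (infdist (S s u x0 t0) A) (t - t0) + c * sup_norm u t0 t)"

definition factorizes_on ::
  "real \<Rightarrow> (real \<Rightarrow> real) \<Rightarrow> (real \<Rightarrow> real) \<Rightarrow> (real \<Rightarrow> real) \<Rightarrow> bool" where
  "factorizes_on M \<gamma> g1 g2 \<longleftrightarrow> (\<forall>a\<in>{0..M}. \<forall>b\<in>{0..M}. \<gamma> (a * b) \<le> g1 a * g2 b)"

definition wandering_dynamics ::
  "(real \<Rightarrow> (real \<Rightarrow> real) set) \<Rightarrow> (real \<Rightarrow> (real \<Rightarrow> 'z) set) \<Rightarrow> 'z system \<Rightarrow>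
     ('z \<Rightarrow> real) \<Rightarrow> (real \<Rightarrow> real) \<Rightarrow> (real \<Rightarrow> real) \<Rightarrow> bool" where
  "wandering_dynamics U Z S h \<gamma>0 \<gamma>1 \<longleftrightarrow>
     forward_complete U Z S \<and> \<gamma>0 \<in> K_inf_e_class \<and> \<gamma>1 \<in> K_inf_e_class \<and>
     (\<forall>s\<ge>0. \<forall>u\<in>U s. \<forall>z0. \<forall>t0\<ge>s. \<forall>t\<ge>t0.
        (\<lambda>\<tau>. \<gamma>1 (u \<tau>)) integrable_on {t0..t} \<and> (\<lambda>\<tau>. \<gamma>0 (u \<tau>)) integrable_on {t0..t} \<and>
        integral {t0..t} (\<lambda>\<tau>. \<gamma>1 (u \<tau>)) \<le> h (S s u z0 t0) - h (S s u z0 t) \<and>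
        h (S s u z0 t0) - h (S s u z0 t) \<le> integral {t0..t} (\<lambda>\<tau>. \<gamma>0 (u \<tau>))) \<and>
     (\<forall>M\<ge>0. \<exists>g1 g2. (\<forall>a\<ge>0. 0 \<le> g1 a) \<and> (\<forall>b\<ge>0. 0 \<le> g2 b) \<and> factorizes_on M \<gamma>0 g1 g2)"

text \<open>\<open>(x, z)\<close> is a trajectory on \<open>[t0,\<infinity>)\<close> of the interconnection
  \<open>ua t = h (z t)\<close>, \<open>uw t = infdist (x t) A\<close>.\<close>

definition interconnection_trajectory ::
  "(real \<Rightarrow> (real \<Rightarrow> real) set) \<Rightarrow> 'x::metric_space system \<Rightarrow>
   (real \<Rightarrow> (real \<Rightarrow> real) set) \<Rightarrow> 'z system \<Rightarrow>
   'x set \<Rightarrow> ('z \<Rightarrow> real) \<Rightarrow> real \<Rightarrow> (real \<Rightarrow> 'x) \<Rightarrow> (real \<Rightarrow> 'z) \<Rightarrow> bool" where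
  "interconnection_trajectory Ua Sa Uw Sw A h t0 x z \<longleftrightarrow>
     (\<exists>ua\<in>Ua t0. \<exists>uw\<in>Uw t0. \<forall>t\<ge>t0.
        ua t = h (z t) \<and> uw t = infdist (x t) A \<and>
        x t = Sa t0 ua (x t0) t \<and> z t = Sw t0 uw (z t0) t)"

definition P1 :: "(nat \<Rightarrow> real) \<Rightarrow> bool" where
  "P1 \<sigma> \<longleftrightarrow> (strict_mono \<sigma> \<or> strict_mono (\<lambda>n. - \<sigma> n)) \<and> \<sigma> 0 = 1 \<and> \<sigma> \<longlonglongrightarrow> 0"

definition P2 :: "(real \<Rightarrow> real \<Rightarrow> real) \<Rightarrow> (nat \<Rightarrow> real) \<Rightarrow> (nat \<Rightarrow> real) \<Rightarrow> bool" where
  "P2 \<beta> \<xi> \<tau> \<longleftrightarrow> (\<forall>i. \<forall>s\<ge>0. \<forall>T\<ge>\<tau> i. \<beta> s T \<le> \<xi> i * \<beta> s 0)"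

text \<open>\<open>phi \<beta> \<xi> \<rho> i j\<close> is \<open>\<phi>\<^sub>j\<close> of the family built for the index \<open>i\<close>, \<open>j \<le> i\<close>; the functions \<open>\<rho>\<close> are
  allowed to depend on \<open>i\<close> as well, because the inequality characterising them involves
  \<open>phi \<beta> \<xi> \<rho> i (j - 1)\<close>.\<close>

primrec phi :: "(real \<Rightarrow> real \<Rightarrow> real) \<Rightarrow> (nat \<Rightarrow> real) \<Rightarrow> (nat \<Rightarrow> nat \<Rightarrow> real \<Rightarrow> real) \<Rightarrow>
    nat \<Rightarrow> nat \<Rightarrow> real \<Rightarrow> real" where
  "phi \<beta> \<xi> \<rho>\<phi> i 0 = (\<lambda>s. \<beta> s 0)"
| "phi \<beta> \<xi> \<rho>\<phi> i (Suc j) = (\<lambda>s. phi \<beta> \<xi> \<rho>\<phi> i j (\<rho>\<phi> i (Suc j) (\<xi> (i - Suc j) * \<beta> s 0)))"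

definition upsilon :: "(real \<Rightarrow> real \<Rightarrow> real) \<Rightarrow> (nat \<Rightarrow> real) \<Rightarrow> (nat \<Rightarrow> nat \<Rightarrow> real \<Rightarrow> real) \<Rightarrow>
    (nat \<Rightarrow> nat \<Rightarrow> real \<Rightarrow> real) \<Rightarrow> nat \<Rightarrow> nat \<Rightarrow> real \<Rightarrow> real" where
  "upsilon \<beta> \<xi> \<rho>\<phi> \<rho>\<upsilon> i j s =
     (if j = 0 then \<beta> s 0 else phi \<beta> \<xi> \<rho>\<phi> i (j - 1) (\<rho>\<upsilon> i j s))"

definition admissible_rho :: "(real \<Rightarrow> real \<Rightarrow> real) \<Rightarrow> (nat \<Rightarrow> real) \<Rightarrow>
    (nat \<Rightarrow> nat \<Rightarrow> real \<Rightarrow> real) \<Rightarrow> (nat \<Rightarrow> nat \<Rightarrow> real \<Rightarrow> real) \<Rightarrow> bool" where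
  "admissible_rho \<beta> \<xi> \<rho>\<phi> \<rho>\<upsilon> \<longleftrightarrow>
     (\<forall>i. \<forall>j\<in>{1..i}. \<rho>\<phi> i j \<in> K_class \<and> \<rho>\<upsilon> i j \<in> K_class \<and>
        (\<forall>a\<ge>0. \<forall>b\<ge>0. phi \<beta> \<xi> \<rho>\<phi> i (j - 1) (a + b)
            \<le> phi \<beta> \<xi> \<rho>\<phi> i (j - 1) (\<rho>\<phi> i j a) + phi \<beta> \<xi> \<rho>\<phi> i (j - 1) (\<rho>\<upsilon> i j b)))"

definition P3 :: "(real \<Rightarrow> real \<Rightarrow> real) \<Rightarrow> real \<Rightarrow> 'x::metric_space set \<Rightarrow> ('z \<Rightarrow> real) \<Rightarrow>
    (nat \<Rightarrow> real) \<Rightarrow> (nat \<Rightarrow> real) \<Rightarrow> (nat \<Rightarrow> nat \<Rightarrow> real \<Rightarrow> real) \<Rightarrow> (nat \<Rightarrow> nat \<Rightarrow> real \<Rightarrow> real) \<Rightarrow>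
    (real \<Rightarrow> real) \<Rightarrow> (real \<Rightarrow> real \<Rightarrow> real) \<Rightarrow> bool" where
  "P3 \<beta> c A h \<sigma> \<xi> \<rho>\<phi> \<rho>\<upsilon> B1 B2 \<longleftrightarrow>
     admissible_rho \<beta> \<xi> \<rho>\<phi> \<rho>\<upsilon> \<and>
     (\<forall>n x0. inverse (\<sigma> n) * phi \<beta> \<xi> \<rho>\<phi> n n (infdist x0 A) \<le> B1 (infdist x0 A)) \<and>
     (\<forall>n z0. inverse (\<sigma> n) * (\<Sum>i=0..n. upsilon \<beta> \<xi> \<rho>\<phi> \<rho>\<upsilon> n i (c * \<bar>h z0\<bar> * \<sigma> (n - i)))
        \<le> B2 \<bar>h z0\<bar> c)"

definition gain_argument :: "'x::metric_space set \<Rightarrow> ('z \<Rightarrow> real) \<Rightarrow> real \<Rightarrow>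
    (real \<Rightarrow> real) \<Rightarrow> (real \<Rightarrow> real \<Rightarrow> real) \<Rightarrow> 'x \<Rightarrow> 'z \<Rightarrow> real" where
  "gain_argument A h c B1 B2 x0 z0 = B1 (infdist x0 A) + B2 \<bar>h z0\<bar> c + c * \<bar>h z0\<bar>"

definition Omega_gamma :: "'x::metric_space set \<Rightarrow> ('z \<Rightarrow> real) \<Rightarrow> real \<Rightarrow>
    (real \<Rightarrow> real) \<Rightarrow> (real \<Rightarrow> real \<Rightarrow> real) \<Rightarrow> (real \<Rightarrow> real) \<Rightarrow> real \<Rightarrow> ('x \<times> 'z) set" where
  "Omega_gamma A h c B1 B2 g2 \<Delta>0 =
     {(x0, z0). g2 (gain_argument A h c B1 B2 x0 z0) \<le> h z0 * \<Delta>0}"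

definition generated_by_autonomous_ode ::
  "(real \<Rightarrow> (real \<Rightarrow> 'x::real_normed_vector) \<Rightarrow> (real \<Rightarrow> 'z::real_normed_vector) \<Rightarrow> bool) \<Rightarrow> bool" where
  "generated_by_autonomous_ode traj \<longleftrightarrow>
     (\<exists>f :: 'x \<times> 'z \<Rightarrow> 'x \<times> 'z. local_lipschitz UNIV UNIV (\<lambda>_::real. f) \<and>
        (\<forall>t0\<ge>0. \<forall>x z. traj t0 x z \<longrightarrow>
           (\<forall>t\<ge>t0. ((\<lambda>t. (x t, z t)) has_vector_derivative f (x t, z t)) (at t within {t0..}))))"

text \<open>The constant is allowed to depend on the initial state: at \<open>t = t0\<close> the estimate reads
  \<open>norm z0 \<le> C\<close>, which no single \<open>C\<close> can satisfy for all \<open>z0\<close>.\<close>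

definition practically_iISS ::
  "(real \<Rightarrow> (real \<Rightarrow> real) set) \<Rightarrow> 'z::real_normed_vector system \<Rightarrow> (real \<Rightarrow> real) \<Rightarrow> bool" where
  "practically_iISS U S \<gamma>1 \<longleftrightarrow>
     (\<forall>z0. \<exists>C. \<forall>t0\<ge>0. \<forall>u\<in>U t0. \<forall>t\<ge>t0.
        sup_norm (S t0 u z0) t0 t \<le> C + integral {t0..t} (\<lambda>\<tau>. \<gamma>1 (u \<tau>)))"

definition steady_state_characteristic ::
  "(real \<Rightarrow> (real \<Rightarrow> real) set) \<Rightarrow> 'x::metric_space system \<Rightarrow> 'x set \<Rightarrow> (real \<Rightarrow> real set) \<Rightarrow> bool" where
  "steady_state_characteristic U S A chi \<longleftrightarrow>
     (\<forall>v. chi v \<subseteq> {0..}) \<and>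
     (\<forall>v. \<forall>t0\<ge>0. \<forall>u\<in>U t0. (u \<longlongrightarrow> v) at_top \<longrightarrow>
        (\<forall>x0. \<exists>L\<in>chi v. ((\<lambda>t. infdist (S t0 u x0 t) A) \<longlongrightarrow> L) at_top))"

definition Omega_a :: "'x::metric_space set \<Rightarrow> ('z \<Rightarrow> real) \<Rightarrow> (real \<Rightarrow> real set) \<Rightarrow> ('x \<times> 'z) set" where
  "Omega_a A h chi = {(x, z). infdist x A = 0 \<and> h z \<in> {v. 0 \<le> v \<and> 0 \<in> chi v}}"

text \<open>Nonemptiness is part of the notion since \<open>infdist\<close> to the empty set is \<open>0\<close>.\<close>

definition converges_to_set :: "(real \<Rightarrow> 'a::metric_space) \<Rightarrow> 'a set \<Rightarrow> bool" where
  "converges_to_set y S \<longleftrightarrow> S \<noteq> {} \<and> ((\<lambda>t. infdist (y t) S) \<longlongrightarrow> 0) at_top"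

end

theory Submission
  imports Defs
begin

text \<open>
  Along a trajectory of the interconnection only two scalar signals matter: the distance
  \<open>a t = infdist (x t) A\<close> and the output \<open>y t = h (z t)\<close>. The lower integral estimate makes \<open>y\<close>
  decreasing. The heart of the matter is that \<open>y\<close> never becomes negative
  (\<open>scalar_loop.output_nonneg_of_pos\<close> and \<open>scalar_loop.output_nonneg_of_zero\<close>); after that
  everything is soft: \<open>y\<close> has a limit \<open>v \<ge> 0\<close>, the steady-state characteristic gives \<open>a\<close> a limit in
  \<open>chi v\<close>, this limit is \<open>0\<close> because \<open>\<gamma>1 \<circ> a\<close> has bounded integrals, and since the state stays
  bounded, all its limit points have distance \<open>0\<close> to \<open>A\<close> and output \<open>v\<close>
  (\<open>converges_to_set_of_bounded\<close>).

  If \<open>y\<close> starts at \<open>y0 > 0\<close> and becomes negative, it passes all levels \<open>\<sigma> i * y0\<close> in finite time.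
  Suppose that it has spent at least the time \<open>\<tau> k\<close> between the levels \<open>k\<close> and \<open>k + 1\<close>, for all
  \<open>k < i\<close>. Then during each passage \<open>a\<close> was contracted by the factor \<open>\<xi> k\<close>, and condition \<open>P3\<close>
  bounds \<open>a\<close> during the next passage by \<open>\<sigma> i\<close> times the gain argument (\<open>iterated_contraction\<close>).
  Hence the rate of decrease of \<open>y\<close> is so small that this passage also takes at least the time
  \<open>\<tau> i\<close> (\<open>scalar_loop.passage_time\<close>). As the sum of all \<open>\<tau> i\<close> is infinite, the levels cannot be
  exhausted in finite time.

  The boundary case \<open>y0 = 0\<close> needs a different argument. Membership in \<open>Omega_gamma\<close> then forces
  the gain argument, and with it the initial distance, to be \<open>0\<close>. As long as \<open>y \<le> 0\<close>, contraction
  from rest gives \<open>a \<le> c * \<bar>y\<bar>\<close>, hence \<open>\<bar>y\<bar>\<close> grows at most at the rate \<open>\<gamma>0 (c * \<bar>y\<bar>)\<close>. The same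
  sequences show that the integral of \<open>1 / \<gamma>0\<close> diverges at \<open>0\<close>, and \<open>\<bar>y\<bar>\<close> cannot leave \<open>0\<close>,
  as in Osgood's uniqueness theorem.
\<close>

section \<open>Comparison functions and iterated contraction\<close>

lemma K_class_mono: "\<kappa> \<in> K_class \<Longrightarrow> 0 \<le> s \<Longrightarrow> s \<le> t \<Longrightarrow> \<kappa> s \<le> \<kappa> t"
  unfolding K_class_def strict_mono_on_def by (cases "s = t") (auto simp: less_eq_real_def)

lemma K_class_nonneg: "\<kappa> \<in> K_class \<Longrightarrow> 0 \<le> s \<Longrightarrow> 0 \<le> \<kappa> s"
  using K_class_mono[of \<kappa> 0 s] by (simp add: K_class_def)

lemma K_class_pos: "\<kappa> \<in> K_class \<Longrightarrow> 0 < s \<Longrightarrow> 0 < \<kappa> s"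
  using strict_mono_onD[of "{0..}" \<kappa> 0 s] by (simp add: K_class_def)

lemma KL_class_K_class: "\<beta> \<in> KL_class \<Longrightarrow> (\<lambda>s. \<beta> s 0) \<in> K_class"
  by (simp add: KL_class_def)

lemma KL_class_le_initial: "\<beta> \<in> KL_class \<Longrightarrow> 0 \<le> s \<Longrightarrow> 0 \<le> T \<Longrightarrow> \<beta> s T \<le> \<beta> s 0"
  by (auto simp: KL_class_def monotone_on_def)

lemma phi_mono_nonneg:
  assumes \<beta>: "\<beta> \<in> KL_class" and \<rho>: "admissible_rho \<beta> \<xi> \<rho>\<phi> \<rho>\<upsilon>" and \<xi>: "\<And>i. 0 \<le> \<xi> i"
    and "j \<le> n"
  shows "(\<forall>s\<ge>0. 0 \<le> phi \<beta> \<xi> \<rho>\<phi> n j s) \<and>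
    (\<forall>s\<ge>0. \<forall>t\<ge>s. phi \<beta> \<xi> \<rho>\<phi> n j s \<le> phi \<beta> \<xi> \<rho>\<phi> n j t)"
  using \<open>j \<le> n\<close>
proof (induction j)
  case 0
  then show ?case
    using K_class_nonneg[OF KL_class_K_class[OF \<beta>]] K_class_mono[OF KL_class_K_class[OF \<beta>]] by auto
next
  case (Suc j)
  have \<rho>K: "\<rho>\<phi> n (Suc j) \<in> K_class"
    using \<rho> Suc.prems by (auto simp: admissible_rho_def)
  have arg: "0 \<le> \<xi> k * \<beta> s 0" "s \<le> t \<Longrightarrow> \<xi> k * \<beta> s 0 \<le> \<xi> k * \<beta> t 0" if "0 \<le> s" for s t k
    using that \<xi>[of k] K_class_nonneg[OF KL_class_K_class[OF \<beta>]]
      K_class_mono[OF KL_class_K_class[OF \<beta>]] by (auto intro: mult_left_mono)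
  show ?case
    using Suc arg K_class_nonneg[OF \<rho>K] K_class_mono[OF \<rho>K] by simp
qed

text \<open>The functions \<open>\<phi>\<close> and \<open>\<upsilon>\<close> arise by unrolling the recursion backwards from the last index:
  one step inserts the estimate of \<open>a (Suc k)\<close> into a monotone \<open>\<phi>\<^sub>j\<close> and splits the sum by means of
  the functions \<open>\<rho>\<close>, which turns the first part into \<open>\<phi>\<^sub>j\<^sub>+\<^sub>1 (a k)\<close> and leaves \<open>\<upsilon>\<^sub>j\<^sub>+\<^sub>1 (d k)\<close>.\<close>

lemma iterated_contraction:
  assumes \<beta>: "\<beta> \<in> KL_class" and \<rho>: "admissible_rho \<beta> \<xi> \<rho>\<phi> \<rho>\<upsilon>" and \<xi>: "\<And>i. 0 \<le> \<xi> i"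
    and a: "\<And>k. k \<le> n \<Longrightarrow> 0 \<le> a k" and d: "\<And>k. k < n \<Longrightarrow> 0 \<le> d k"
    and step: "\<And>k. k < n \<Longrightarrow> a (Suc k) \<le> \<xi> k * \<beta> (a k) 0 + d k"
    and "j \<le> n"
  shows "\<beta> (a n) 0 \<le> phi \<beta> \<xi> \<rho>\<phi> n j (a (n - j)) + (\<Sum>i=1..j. upsilon \<beta> \<xi> \<rho>\<phi> \<rho>\<upsilon> n i (d (n - i)))"
  using \<open>j \<le> n\<close>
proof (induction j)
  case 0
  then show ?case by simp
next
  case (Suc j)
  define k where "k = n - Suc j"
  have k: "k < n" "n - j = Suc k" "n - Suc j = k"
    using Suc.prems by (auto simp: k_def)
  have \<xi>\<beta>: "0 \<le> \<xi> k * \<beta> (a k) 0"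
    using \<xi>[of k] K_class_nonneg[OF KL_class_K_class[OF \<beta>] a[of k]] k by simp
  have "phi \<beta> \<xi> \<rho>\<phi> n j (a (n - j)) \<le> phi \<beta> \<xi> \<rho>\<phi> n j (\<xi> k * \<beta> (a k) 0 + d k)"
    using phi_mono_nonneg[OF \<beta> \<rho> \<xi>, of j n] Suc.prems a[of "Suc k"] step[of k] k by auto
  also have "\<dots> \<le> phi \<beta> \<xi> \<rho>\<phi> n j (\<rho>\<phi> n (Suc j) (\<xi> k * \<beta> (a k) 0))
      + phi \<beta> \<xi> \<rho>\<phi> n j (\<rho>\<upsilon> n (Suc j) (d k))"
  proof -
    have "Suc j \<in> {1..n}" using Suc.prems by simp
    then show ?thesis
      using \<rho> \<xi>\<beta> d[OF k(1)] unfolding admissible_rho_def by (metis diff_Suc_1)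
  qed
  also have "\<dots> = phi \<beta> \<xi> \<rho>\<phi> n (Suc j) (a k) + upsilon \<beta> \<xi> \<rho>\<phi> \<rho>\<upsilon> n (Suc j) (d k)"
    by (simp add: upsilon_def k)
  finally show ?case
    using Suc k by simp
qed

section \<open>Level sequences\<close>

lemma P1_decreasing:
  assumes "P1 \<sigma>"
  shows "0 < \<sigma> n" and "\<sigma> n \<le> 1" and "\<sigma> (Suc n) < \<sigma> n"
proof -
  have "\<not> strict_mono \<sigma>"
  proof
    assume "strict_mono \<sigma>"
    then have "\<sigma> 0 \<le> 0"
      using assms by (intro incseq_le) (auto simp: P1_def strict_mono_mono)
    then show False using assms by (simp add: P1_def)
  qed
  then have "strict_mono (\<lambda>n. - \<sigma> n)"
    using assms by (simp add: P1_def)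
  then show less: "\<sigma> (Suc n) < \<sigma> n" for n
    by (simp add: strict_mono_def)
  have "decseq \<sigma>"
    using less by (intro decseq_SucI) (simp add: less_imp_le)
  then have "0 \<le> \<sigma> (Suc n)" "\<sigma> n \<le> \<sigma> 0" for n
    using assms decseq_ge[of \<sigma> 0] decseqD[of \<sigma> 0 n] by (auto simp: P1_def)
  from this[of n] show "0 < \<sigma> n" "\<sigma> n \<le> 1"
    using less[of n] assms by (auto simp: P1_def)
qed

text \<open>The relation between the gaps of \<open>\<sigma>\<close> and the times \<open>\<tau>\<close>, solved for the gain: up to the constant
  \<open>g2 b / \<Delta>0\<close>, the gain at the level \<open>\<sigma> i\<close> is at most the speed that covers the gap to the next
  level in the time \<open>\<tau> i\<close>.\<close>

lemma gain_at_level: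
  assumes fac: "factorizes_on M \<gamma>0 g1 g2" and "\<sigma> i \<in> {0..M}" "b \<in> {0..M}"
    and g1: "\<forall>s\<ge>0. 0 \<le> g1 s" and g2: "\<forall>s\<ge>0. 0 \<le> g2 s"
    and "0 < \<Delta>0" "0 < \<tau> i"
    and speed: "1 / \<tau> i * ((\<sigma> i - \<sigma> (Suc i)) / g1 (\<sigma> i)) \<ge> \<Delta>0"
  shows "\<tau> i * \<gamma>0 (\<sigma> i * b) \<le> g2 b / \<Delta>0 * (\<sigma> i - \<sigma> (Suc i))"
proof -
  \<comment> \<open>division by zero yields \<open>0\<close>, which is not at least \<open>\<Delta>0\<close>\<close>
  have "g1 (\<sigma> i) \<noteq> 0"
    using speed \<open>0 < \<Delta>0\<close> by auto
  then have "0 < g1 (\<sigma> i)"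
    using g1 assms(2) by (auto simp: less_le)
  then have "\<tau> i * g1 (\<sigma> i) \<le> (\<sigma> i - \<sigma> (Suc i)) / \<Delta>0"
    using speed \<open>0 < \<Delta>0\<close> \<open>0 < \<tau> i\<close> by (simp add: field_simps)
  then have "(\<tau> i * g1 (\<sigma> i)) * g2 b \<le> (\<sigma> i - \<sigma> (Suc i)) / \<Delta>0 * g2 b"
    using g2 assms(3) by (intro mult_right_mono) auto
  moreover have "\<tau> i * \<gamma>0 (\<sigma> i * b) \<le> \<tau> i * (g1 (\<sigma> i) * g2 b)"
    using fac assms(2,3) \<open>0 < \<tau> i\<close> by (auto simp: factorizes_on_def)
  ultimately show ?thesis by (simp add: mult_ac)
qed

section \<open>The scalar feedback loop\<close>

text \<open>The signals \<open>a\<close> and \<open>y\<close> of a trajectory. The contraction estimate is stated for every upper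
  bound \<open>m\<close> of \<open>\<bar>y\<bar>\<close>, so that suprema do not appear.\<close>

locale scalar_loop =
  fixes a y :: "real \<Rightarrow> real" and \<beta> :: "real \<Rightarrow> real \<Rightarrow> real" and c :: real
    and \<gamma>0 :: "real \<Rightarrow> real" and t0 :: real
  assumes KL: "\<beta> \<in> KL_class" and c_pos: "0 < c" and K: "\<gamma>0 \<in> K_class"
    and a_nonneg: "t0 \<le> t \<Longrightarrow> 0 \<le> a t"
    and y_cont: "continuous_on {t0..} y"
    and y_antimono: "t0 \<le> s \<Longrightarrow> s \<le> t \<Longrightarrow> y t \<le> y s"
    and contraction: "t0 \<le> s \<Longrightarrow> s \<le> t \<Longrightarrow> (\<And>r. s \<le> r \<Longrightarrow> r \<le> t \<Longrightarrow> \<bar>y r\<bar> \<le> m) \<Longrightarrow>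
      a t \<le> \<beta> (a s) (t - s) + c * m"
    and gain_integrable: "t0 \<le> s \<Longrightarrow> s \<le> t \<Longrightarrow> (\<lambda>r. \<gamma>0 (a r)) integrable_on {s..t}"
    and decrease: "t0 \<le> s \<Longrightarrow> s \<le> t \<Longrightarrow> y s - y t \<le> integral {s..t} (\<lambda>r. \<gamma>0 (a r))"
begin

lemma decrease_le:
  assumes "t0 \<le> s" "s \<le> t" and m: "\<And>r. s \<le> r \<Longrightarrow> r \<le> t \<Longrightarrow> a r \<le> m"
  shows "y s - y t \<le> (t - s) * \<gamma>0 m"
proof -
  have "integral {s..t} (\<lambda>r. \<gamma>0 (a r)) \<le> integral {s..t} (\<lambda>r. \<gamma>0 m)"
    using assms a_nonneg by (intro integral_le gain_integrable K_class_mono[OF K]) auto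
  then show ?thesis
    using decrease[OF assms(1,2)] assms(2) by simp
qed

text \<open>A passage from one level to the next at speed at most \<open>\<gamma>0 (\<sigma> i * b)\<close>. The factor \<open>k\<close> allows
  for levels of \<open>y\<close> proportional to \<open>\<sigma>\<close>.\<close>

lemma passage_time:
  assumes "t0 \<le> s" "s \<le> t" and "\<And>r. s \<le> r \<Longrightarrow> r \<le> t \<Longrightarrow> a r \<le> \<sigma> i * b"
    and drop: "y s - y t = k * (\<sigma> i - \<sigma> (Suc i))" and "\<sigma> (Suc i) < \<sigma> i"
    and "0 < \<tau> i" and level: "\<tau> i * \<gamma>0 (\<sigma> i * b) \<le> L * (\<sigma> i - \<sigma> (Suc i))"
  shows "\<tau> i * k \<le> (t - s) * L"
proof -
  have "\<tau> i * (k * (\<sigma> i - \<sigma> (Suc i))) \<le> \<tau> i * ((t - s) * \<gamma>0 (\<sigma> i * b))"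
    using decrease_le[OF assms(1-3)] drop \<open>0 < \<tau> i\<close> by (intro mult_left_mono) auto
  also have "\<dots> = (t - s) * (\<tau> i * \<gamma>0 (\<sigma> i * b))" by simp
  also have "\<dots> \<le> (t - s) * (L * (\<sigma> i - \<sigma> (Suc i)))"
    using level assms(2) by (intro mult_left_mono) auto
  finally have "(\<tau> i * k) * (\<sigma> i - \<sigma> (Suc i)) \<le> ((t - s) * L) * (\<sigma> i - \<sigma> (Suc i))"
    by (simp add: algebra_simps)
  then show ?thesis
    using assms(5) by (simp add: mult_le_cancel_right)
qed

lemma level_time:
  assumes "t0 \<le> T" "y T \<le> l" "l \<le> y t0"
  shows "\<exists>s. t0 \<le> s \<and> s \<le> T \<and> y s = l"
  using assms by (intro IVT2' continuous_on_subset[OF y_cont]) auto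

lemma level_time_order: "t0 \<le> s \<Longrightarrow> t0 \<le> t \<Longrightarrow> y t < y s \<Longrightarrow> s \<le> t"
  using y_antimono[of t s] by force

text \<open>Each earlier passage was long enough to contract \<open>a\<close> by the factor \<open>\<xi> k\<close>, up to the input, which
  during that passage was at most \<open>c * \<sigma> k * y t0\<close>. Iterating these contractions bounds \<open>a\<close> at the
  start of the passage from level \<open>n\<close> to level \<open>n + 1\<close>, and the contraction estimate carries the
  bound through the passage.\<close>

lemma passage_bound:
  assumes y0: "0 \<le> y t0" and \<xi>: "\<And>i. 0 \<le> \<xi> i"
    and \<sigma>: "P1 \<sigma>" and P2: "P2 \<beta> \<xi> \<tau>" and \<rho>: "admissible_rho \<beta> \<xi> \<rho>\<phi> \<rho>\<upsilon>"
    and b1: "inverse (\<sigma> n) * phi \<beta> \<xi> \<rho>\<phi> n n (a t0) \<le> b1"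
    and b2: "inverse (\<sigma> n) * (\<Sum>i=0..n. upsilon \<beta> \<xi> \<rho>\<phi> \<rho>\<upsilon> n i (c * y t0 * \<sigma> (n - i))) \<le> b2"
    and s0: "s 0 = t0" and s_ge: "\<And>i. t0 \<le> s i" and s_le: "\<And>i. s i \<le> s (Suc i)"
    and ys: "\<And>i. y (s i) = \<sigma> i * y t0"
    and dwell: "\<And>k. k < n \<Longrightarrow> \<tau> k \<le> s (Suc k) - s k"
    and r: "s n \<le> r" "r \<le> s (Suc n)"
  shows "a r \<le> \<sigma> n * (b1 + b2 + c * y t0)"
proof -
  have y_le: "\<bar>y r\<bar> \<le> \<sigma> i * y t0" if "s i \<le> r" "r \<le> s (Suc i)" for i r
  proof -
    have "t0 \<le> r" using s_ge[of i] that(1) by (rule order_trans)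
    then have "\<sigma> (Suc i) * y t0 \<le> y r" "y r \<le> \<sigma> i * y t0"
      using y_antimono[of r "s (Suc i)"] y_antimono[of "s i" r] that s_ge[of i] ys by auto
    moreover have "0 \<le> \<sigma> (Suc i) * y t0"
      using P1_decreasing(1)[OF \<sigma>, of "Suc i"] y0 by simp
    ultimately show ?thesis by simp
  qed
  have \<beta>\<phi>: "\<beta> (a (s n)) 0 \<le> phi \<beta> \<xi> \<rho>\<phi> n n (a (s (n - n)))
      + (\<Sum>i=1..n. upsilon \<beta> \<xi> \<rho>\<phi> \<rho>\<upsilon> n i (c * y t0 * \<sigma> (n - i)))"
  proof (rule iterated_contraction[OF KL \<rho> \<xi>, where a = "\<lambda>k. a (s k)"
        and d = "\<lambda>k. c * y t0 * \<sigma> k"])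
    show "0 \<le> a (s k)" for k
      by (rule a_nonneg[OF s_ge])
    show "0 \<le> c * y t0 * \<sigma> k" for k
      using c_pos y0 P1_decreasing(1)[OF \<sigma>, of k] by simp
    show "a (s (Suc k)) \<le> \<xi> k * \<beta> (a (s k)) 0 + c * y t0 * \<sigma> k" if "k < n" for k
    proof -
      have "a (s (Suc k)) \<le> \<beta> (a (s k)) (s (Suc k) - s k) + c * (\<sigma> k * y t0)"
        by (rule contraction[OF s_ge s_le]) (use y_le in auto)
      moreover have "\<beta> (a (s k)) (s (Suc k) - s k) \<le> \<xi> k * \<beta> (a (s k)) 0"
        using P2 dwell[OF that] a_nonneg[OF s_ge] by (simp add: P2_def)
      ultimately show ?thesis by (simp add: algebra_simps)
    qed
  qed simp
  \<comment> \<open>the term \<open>i = 0\<close> is part of the sum bounded by \<open>b2\<close>, but is not produced by the iteration\<close>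
  have "0 \<le> upsilon \<beta> \<xi> \<rho>\<phi> \<rho>\<upsilon> n 0 (c * y t0 * \<sigma> (n - 0))"
    using K_class_nonneg[OF KL_class_K_class[OF KL], of "c * y t0 * \<sigma> n"] c_pos y0
      P1_decreasing(1)[OF \<sigma>, of n] by (simp add: upsilon_def)
  then have "(\<Sum>i=1..n. upsilon \<beta> \<xi> \<rho>\<phi> \<rho>\<upsilon> n i (c * y t0 * \<sigma> (n - i)))
      \<le> (\<Sum>i=0..n. upsilon \<beta> \<xi> \<rho>\<phi> \<rho>\<upsilon> n i (c * y t0 * \<sigma> (n - i)))"
    by (simp add: sum.atLeast_Suc_atMost)
  also have "\<dots> \<le> \<sigma> n * b2"
    using b2 P1_decreasing(1)[OF \<sigma>, of n] by (simp add: field_simps)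
  finally have "\<beta> (a (s n)) 0 \<le> \<sigma> n * b1 + \<sigma> n * b2"
    using \<beta>\<phi> b1 s0 P1_decreasing(1)[OF \<sigma>, of n] by (simp add: field_simps)
  moreover have "a r \<le> \<beta> (a (s n)) (r - s n) + c * (\<sigma> n * y t0)"
    by (rule contraction[OF s_ge r(1)]) (use y_le r in auto)
  moreover have "\<beta> (a (s n)) (r - s n) \<le> \<beta> (a (s n)) 0"
    using KL_class_le_initial[OF KL a_nonneg[OF s_ge]] r(1) by simp
  ultimately show ?thesis by (simp add: algebra_simps)
qed

text \<open>The bound on a passage and the lower bound on its duration feed each other: durations of the
  earlier passages yield the bound on \<open>a\<close> in the next one, and this bound yields its duration. Only
  the constants \<open>b1\<close> and \<open>b2\<close>, which serve all \<open>n\<close> at once, keep the induction from deteriorating.\<close>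

lemma output_nonneg_of_pos:
  assumes y0: "0 < y t0" and \<xi>: "\<And>i. 0 \<le> \<xi> i" and \<tau>: "\<And>i. 0 < \<tau> i"
    and \<sigma>: "P1 \<sigma>" and P2: "P2 \<beta> \<xi> \<tau>" and \<rho>: "admissible_rho \<beta> \<xi> \<rho>\<phi> \<rho>\<upsilon>"
    and b1: "\<And>n. inverse (\<sigma> n) * phi \<beta> \<xi> \<rho>\<phi> n n (a t0) \<le> b1"
    and b2: "\<And>n. inverse (\<sigma> n) * (\<Sum>i=0..n. upsilon \<beta> \<xi> \<rho>\<phi> \<rho>\<upsilon> n i (c * y t0 * \<sigma> (n - i))) \<le> b2"
    and level: "\<And>i. \<tau> i * \<gamma>0 (\<sigma> i * (b1 + b2 + c * y t0)) \<le> L * (\<sigma> i - \<sigma> (Suc i))"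
    and L: "L \<le> y t0"
    and diverges: "filterlim (\<lambda>n. \<Sum>i<n. \<tau> i) at_top sequentially"
    and "t0 \<le> T"
  shows "0 \<le> y T"
proof (rule ccontr)
  assume neg: "\<not> 0 \<le> y T"
  note \<sigma>' = P1_decreasing[OF \<sigma>]
  have "\<exists>s. t0 \<le> s \<and> s \<le> T \<and> y s = \<sigma> i * y t0" for i
  proof (rule level_time[OF \<open>t0 \<le> T\<close>])
    show "y T \<le> \<sigma> i * y t0"
      using neg y0 mult_pos_pos[OF \<sigma>'(1)[of i] y0] by linarith
    show "\<sigma> i * y t0 \<le> y t0"
      using \<sigma>'(2)[of i] y0 by simp
  qed
  then have "\<forall>i. \<exists>s. t0 \<le> s \<and> s \<le> T \<and> y s = \<sigma> i * y t0"
    by blast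
  from choice[OF this] obtain s' where s': "\<And>i. t0 \<le> s' i \<and> s' i \<le> T \<and> y (s' i) = \<sigma> i * y t0"
    by blast
  \<comment> \<open>the output may rest at its initial level, and the initial bounds are available only at \<open>t0\<close>\<close>
  define s where "s = s'(0 := t0)"
  have s0: "s 0 = t0" by (simp add: s_def)
  have "\<sigma> 0 = 1" using \<sigma> by (simp add: P1_def)
  have s_ge: "t0 \<le> s i" and s_T: "s i \<le> T" and ys: "y (s i) = \<sigma> i * y t0" for i
    using s'[of i] \<open>\<sigma> 0 = 1\<close> \<open>t0 \<le> T\<close> by (auto simp: s_def)
  have s_le: "s i \<le> s (Suc i)" for i
    by (rule level_time_order[OF s_ge s_ge]) (use \<sigma>'(3)[of i] y0 in \<open>simp add: ys\<close>)
  have dwell: "\<tau> n \<le> s (Suc n) - s n" for n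
  proof (induction n rule: less_induct)
    case (less n)
    have a_le: "a r \<le> \<sigma> n * (b1 + b2 + c * y t0)" if "s n \<le> r" "r \<le> s (Suc n)" for r
      by (rule passage_bound[where s = s and n = n and \<xi> = \<xi> and \<tau> = \<tau> and \<sigma> = \<sigma>
            and \<rho>\<phi> = \<rho>\<phi> and \<rho>\<upsilon> = \<rho>\<upsilon>])
        (fact less_imp_le[OF y0] \<xi> \<sigma> P2 \<rho> b1 b2 s0 s_ge s_le ys less.IH that)+
    have drop: "y (s n) - y (s (Suc n)) = y t0 * (\<sigma> n - \<sigma> (Suc n))"
      by (simp add: ys algebra_simps)
    have "\<tau> n * y t0 \<le> (s (Suc n) - s n) * L"
      by (rule passage_time[where \<sigma> = \<sigma> and \<tau> = \<tau>, OF s_ge s_le a_le drop \<sigma>'(3) \<tau> level])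
    also have "\<dots> \<le> (s (Suc n) - s n) * y t0"
      using L s_le[of n] by (intro mult_left_mono) auto
    finally show ?case
      using y0 by simp
  qed
  have "(\<Sum>i<n. \<tau> i) \<le> T - t0" for n
  proof -
    have "(\<Sum>i<n. \<tau> i) \<le> (\<Sum>i<n. s (Suc i) - s i)"
      by (rule sum_mono) (rule dwell)
    also have "\<dots> = s n - s 0"
      by (rule sum_lessThan_telescope)
    finally show ?thesis using s_T[of n] s0 by simp
  qed
  moreover have "\<forall>\<^sub>F n in sequentially. T - t0 < (\<Sum>i<n. \<tau> i)"
    using diverges by (simp add: filterlim_at_top_dense)
  then obtain n where "T - t0 < (\<Sum>i<n. \<tau> i)"
    using eventually_happens'[OF sequentially_bot] by blast
  ultimately show False by (meson not_le)
qed

text \<open>If the loop starts at rest, then \<open>a \<le> c * \<bar>y\<bar>\<close>. Were \<open>c * \<bar>y\<bar>\<close> to become positive, it would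
  cross all sufficiently low levels \<open>\<sigma> i\<close> in finite time, in the order of decreasing \<open>i\<close>; but each
  crossing takes a time proportional to \<open>\<tau> i\<close>, and these add up to infinity.\<close>

lemma output_nonneg_of_zero:
  assumes y0: "y t0 = 0" and a0: "a t0 = 0" and \<tau>: "\<And>i. 0 < \<tau> i" and \<sigma>: "P1 \<sigma>"
    and level: "\<And>i. \<tau> i * \<gamma>0 (\<sigma> i) \<le> L * (\<sigma> i - \<sigma> (Suc i))"
    and diverges: "filterlim (\<lambda>n. \<Sum>i<n. \<tau> i) at_top sequentially"
    and "t0 \<le> T"
  shows "0 \<le> y T"
proof (rule ccontr)
  assume neg: "\<not> 0 \<le> y T"
  note \<sigma>' = P1_decreasing[OF \<sigma>]
  have y_le: "y r \<le> 0" if "t0 \<le> r" for r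
    using y_antimono[OF order_refl that] y0 by simp
  have \<beta>0: "\<beta> 0 t \<le> 0" if "0 \<le> t" for t
    using KL_class_le_initial[OF KL order_refl that] KL_class_K_class[OF KL] by (simp add: K_class_def)
  have a_le: "a r \<le> c * (- y r)" if "t0 \<le> r" for r
  proof -
    have "a r \<le> \<beta> (a t0) (r - t0) + c * (- y r)"
      using that y_le y_antimono by (intro contraction) (auto simp: abs_of_nonpos)
    then show ?thesis
      using \<beta>0[of "r - t0"] a0 that by simp
  qed
  have "0 < c * (- y T)"
    using neg c_pos by (intro mult_pos_pos) auto
  then have "\<forall>\<^sub>F n in sequentially. \<sigma> n < c * (- y T)"
    using \<sigma> by (auto simp: P1_def intro: order_tendstoD(2))
  then obtain N where N: "\<And>n. N \<le> n \<Longrightarrow> \<sigma> n < c * (- y T)"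
    unfolding eventually_sequentially by blast
  have "\<exists>s. t0 \<le> s \<and> s \<le> T \<and> y s = - \<sigma> (N + i) / c" for i
  proof (rule level_time[OF \<open>t0 \<le> T\<close>])
    show "y T \<le> - \<sigma> (N + i) / c"
      using N[of "N + i"] c_pos by (simp add: field_simps)
    show "- \<sigma> (N + i) / c \<le> y t0"
      using \<sigma>'(1)[of "N + i"] c_pos y0 by simp
  qed
  then obtain s where s_ge: "\<And>i. t0 \<le> s i" and s_T: "\<And>i. s i \<le> T"
    and ys: "\<And>i. y (s i) = - \<sigma> (N + i) / c"
    by metis
  have s_le: "s (Suc i) \<le> s i" for i
    by (rule level_time_order[OF s_ge s_ge])
      (use \<sigma>'(3)[of "N + i"] c_pos in \<open>simp add: ys field_simps\<close>)
  have passage: "\<tau> (N + i) * (1 / c) \<le> (s i - s (Suc i)) * L" for i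
  proof (rule passage_time[where \<sigma> = \<sigma> and b = 1, OF s_ge s_le _ _ \<sigma>'(3) \<tau>])
    show "a r \<le> \<sigma> (N + i) * 1" if "s (Suc i) \<le> r" "r \<le> s i" for r
    proof -
      have "t0 \<le> r" using that s_ge order_trans by blast
      then have "a r \<le> c * (- y r)" by (rule a_le)
      also have "\<dots> \<le> c * (- y (s i))"
        using y_antimono[OF \<open>t0 \<le> r\<close> that(2)] c_pos by simp
      finally show ?thesis using c_pos by (simp add: ys)
    qed
    show "y (s (Suc i)) - y (s i) = 1 / c * (\<sigma> (N + i) - \<sigma> (Suc (N + i)))"
      using c_pos by (simp add: ys field_simps)
  qed (use level in simp)
  have sum_le: "(\<Sum>i<n. \<tau> (N + i)) \<le> c * ((s 0 - s n) * L)" for n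
  proof -
    have "(\<Sum>i<n. \<tau> (N + i) * (1 / c)) \<le> (\<Sum>i<n. (s i - s (Suc i)) * L)"
      by (rule sum_mono) (rule passage)
    also have "\<dots> = (s 0 - s n) * L"
      by (simp add: sum_distrib_right[symmetric] sum_lessThan_telescope')
    finally show ?thesis
      using c_pos by (simp add: sum_divide_distrib[symmetric] field_simps)
  qed
  have "0 \<le> \<tau> 0 * \<gamma>0 (\<sigma> 0)"
    using \<tau>[of 0] K_class_nonneg[OF K, of "\<sigma> 0"] \<sigma>'(1)[of 0] by simp
  then have "0 \<le> L * (\<sigma> 0 - \<sigma> (Suc 0))" using level[of 0] by linarith
  then have "0 \<le> L"
    using \<sigma>'(3)[of 0] by (simp add: zero_le_mult_iff)
  then have "(\<Sum>i<n. \<tau> (N + i)) \<le> c * ((T - t0) * L)" for n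
    using sum_le[of n] s_ge[of n] s_T[of 0] c_pos
    by (smt (verit) mult_left_mono mult_right_mono)
  moreover have "(\<Sum>i<N + n. \<tau> i) = (\<Sum>i<N. \<tau> i) + (\<Sum>i<n. \<tau> (N + i))" for n
    by (induction n) (auto simp: algebra_simps)
  ultimately have bounded: "(\<Sum>i<N + n. \<tau> i) \<le> (\<Sum>i<N. \<tau> i) + c * ((T - t0) * L)" for n
    by simp
  have "\<forall>\<^sub>F n in sequentially. (\<Sum>i<N. \<tau> i) + c * ((T - t0) * L) < (\<Sum>i<n. \<tau> i)"
    using diverges by (simp add: filterlim_at_top_dense)
  then obtain m where "\<And>n. m \<le> n \<Longrightarrow> (\<Sum>i<N. \<tau> i) + c * ((T - t0) * L) < (\<Sum>i<n. \<tau> i)"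
    unfolding eventually_sequentially by blast
  then show False
    using bounded[of m] by (meson le_add2 not_le)
qed

end

section \<open>Limits\<close>

lemma antimono_bounded_converges:
  fixes y :: "real \<Rightarrow> real"
  assumes antimono: "\<And>s t. t0 \<le> s \<Longrightarrow> s \<le> t \<Longrightarrow> y t \<le> y s" and lower: "\<And>t. t0 \<le> t \<Longrightarrow> l \<le> y t"
  shows "\<exists>v\<ge>l. (y \<longlongrightarrow> v) at_top"
proof (intro exI conjI)
  define v where "v = Inf (y ` {t0..})"
  have bdd: "bdd_below (y ` {t0..})" using lower by (intro bdd_belowI2[of _ l]) auto
  show "l \<le> v" unfolding v_def using lower by (intro cINF_greatest) auto
  have v: "\<forall>t\<ge>t0. v \<le> y t" unfolding v_def by (auto intro: cINF_lower[OF bdd])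
  show "(y \<longlongrightarrow> v) at_top"
  proof (rule decreasing_tendsto)
    show "\<forall>\<^sub>F t in at_top. v \<le> y t"
      using eventually_ge_at_top[of t0] by eventually_elim (use v in auto)
    fix e assume "v < e"
    then obtain s where "t0 \<le> s" "y s < e"
      unfolding v_def by (subst (asm) cINF_less_iff[OF _ bdd]) auto
    show "\<forall>\<^sub>F t in at_top. y t < e"
      using eventually_ge_at_top[of s]
    proof eventually_elim
      case (elim t)
      then show ?case
        using antimono[OF \<open>t0 \<le> s\<close> elim] \<open>y s < e\<close> by linarith
    qed
  qed
qed

text \<open>A positive limit would bound the integrand away from zero, because \<open>\<gamma>\<close> is increasing.\<close>

lemma limit_zero_of_bounded_integrals:
  fixes \<gamma> a :: "real \<Rightarrow> real"
  assumes K: "\<gamma> \<in> K_class" and a: "\<And>t. t0 \<le> t \<Longrightarrow> 0 \<le> a t" and lim: "(a \<longlongrightarrow> l) at_top"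
    and int: "\<And>s t. t0 \<le> s \<Longrightarrow> s \<le> t \<Longrightarrow> (\<lambda>r. \<gamma> (a r)) integrable_on {s..t}"
    and bound: "\<And>s t. t0 \<le> s \<Longrightarrow> s \<le> t \<Longrightarrow> integral {s..t} (\<lambda>r. \<gamma> (a r)) \<le> C"
  shows "l = 0"
proof (rule ccontr)
  assume "l \<noteq> 0"
  have "0 \<le> l"
    by (rule tendsto_lowerbound[OF lim eventually_mono[OF eventually_ge_at_top[of t0] a]]) simp_all
  with \<open>l \<noteq> 0\<close> have l: "0 < l / 2" by simp
  then have "\<forall>\<^sub>F t in at_top. l / 2 < a t"
    by (intro order_tendstoD(1)[OF lim]) simp
  then obtain s' where s': "\<And>t. s' \<le> t \<Longrightarrow> l / 2 < a t"
    unfolding eventually_at_top_linorder by blast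
  define s where "s = max s' t0"
  have k: "0 < \<gamma> (l / 2)" by (rule K_class_pos[OF K l])
  define t where "t = s + (\<bar>C\<bar> + 1) / \<gamma> (l / 2)"
  have "s \<le> t" using k by (simp add: t_def)
  have "integral {s..t} (\<lambda>r. \<gamma> (l / 2)) \<le> integral {s..t} (\<lambda>r. \<gamma> (a r))"
    using \<open>s \<le> t\<close> l s' by (intro integral_le int K_class_mono[OF K]) (auto simp: s_def less_imp_le)
  also have "\<dots> \<le> C"
    by (rule bound) (use \<open>s \<le> t\<close> in \<open>auto simp: s_def\<close>)
  finally show False
    using \<open>s \<le> t\<close> k by (simp add: t_def)
qed

text \<open>By compactness, along any sequence of times the points accumulate, and by continuity they
  do so in the level set of \<open>F\<close>.\<close>

lemma converges_to_set_of_bounded: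
  fixes p :: "real \<Rightarrow> 'a::heine_borel" and F :: "'a \<Rightarrow> 'b::t2_space"
  assumes cont: "continuous_on UNIV F" and bdd: "bounded (p ` {t0..})"
    and lim: "((\<lambda>t. F (p t)) \<longlongrightarrow> l) at_top" and S: "\<And>q. F q = l \<Longrightarrow> q \<in> S"
  shows "converges_to_set p S"
proof -
  have accumulate: "\<exists>q\<in>S. \<exists>k. strict_mono k \<and> (\<lambda>n. p (r (k n))) \<longlonglongrightarrow> q"
    if r: "filterlim r at_top sequentially" and "\<And>n. t0 \<le> r n" for r :: "nat \<Rightarrow> real"
  proof -
    have "bounded (range (\<lambda>n. p (r n)))"
      using that by (intro bounded_subset[OF bdd]) auto
    then obtain q k where k: "strict_mono k" and q: "((\<lambda>n. p (r n)) \<circ> k) \<longlonglongrightarrow> q"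
      by (metis bounded_imp_convergent_subsequence)
    have "(\<lambda>n. F (p (r (k n)))) \<longlonglongrightarrow> F q"
      using continuous_on_tendsto_compose[OF cont q] by (simp add: o_def)
    moreover have "(\<lambda>n. F (p (r (k n)))) \<longlonglongrightarrow> l"
      by (rule filterlim_compose[OF lim])
        (rule filterlim_compose[OF r filterlim_subseq[OF k]])
    ultimately have "F q = l" by (rule LIMSEQ_unique)
    then show ?thesis using S k q by (auto simp: o_def)
  qed
  have "filterlim (\<lambda>n. t0 + real n) at_top sequentially"
    by (intro filterlim_tendsto_add_at_top[OF tendsto_const] filterlim_real_sequentially)
  then have "S \<noteq> {}" using accumulate[of "\<lambda>n. t0 + real n"] by auto
  moreover have "((\<lambda>t. infdist (p t) S) \<longlongrightarrow> 0) at_top"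
  proof (rule ccontr)
    assume "\<not> ?thesis"
    then obtain e where e: "0 < e" "\<not> (\<forall>\<^sub>F t in at_top. infdist (p t) S < e)"
      by (auto simp: tendsto_iff infdist_nonneg)
    then have "\<exists>t. t0 + real n \<le> t \<and> e \<le> infdist (p t) S" for n
      unfolding eventually_at_top_linorder by (meson not_le)
    then obtain r where r: "\<And>n. t0 + real n \<le> r n" "\<And>n. e \<le> infdist (p (r n)) S"
      by metis
    have "filterlim r at_top sequentially"
      by (rule filterlim_at_top_mono[OF \<open>filterlim (\<lambda>n. t0 + real n) at_top sequentially\<close>])
        (use r in auto)
    moreover have "t0 \<le> r n" for n using r(1)[of n] by linarith
    ultimately obtain q k where "q \<in> S" "(\<lambda>n. p (r (k n))) \<longlonglongrightarrow> q"
      using accumulate by blast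
    then have "(\<lambda>n. infdist (p (r (k n))) S) \<longlonglongrightarrow> 0"
      using tendsto_infdist[of _ q sequentially S] by fastforce
    then have "e \<le> 0"
      by (rule tendsto_lowerbound) (use r(2) in auto)
    then show False using e by simp
  qed
  ultimately show ?thesis by (simp add: converges_to_set_def)
qed

section \<open>Convergence of the interconnection\<close>

theorem corollary1:
  fixes Sa :: "(real ^ 'n) system" and Sw :: "(real ^ 'm) system"
    and Ua Uw :: "real \<Rightarrow> (real \<Rightarrow> real) set"
    and X :: "real \<Rightarrow> (real \<Rightarrow> real ^ 'n) set" and Z :: "real \<Rightarrow> (real \<Rightarrow> real ^ 'm) set"
    and A :: "(real ^ 'n) set" and \<beta> :: "real \<Rightarrow> real \<Rightarrow> real" and c :: real
    and h :: "real ^ 'm \<Rightarrow> real" and \<gamma>0 \<gamma>1 \<gamma>01 \<gamma>02 :: "real \<Rightarrow> real"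
    and \<sigma> \<xi> \<tau> :: "nat \<Rightarrow> real" and \<rho>\<phi> \<rho>\<upsilon> :: "nat \<Rightarrow> nat \<Rightarrow> real \<Rightarrow> real"
    and B1 :: "real \<Rightarrow> real" and B2 :: "real \<Rightarrow> real \<Rightarrow> real" and \<Delta>0 :: real
    and chi :: "real \<Rightarrow> real set"
  assumes sys_a: "io_system Ua X Sa" "\<forall>t0\<ge>0. \<forall>u\<in>Ua t0. \<forall>x0. Sa t0 u x0 \<in> X t0"
    and sys_w: "io_system Uw Z Sw"
    and contracting: "contracting_dynamics Ua Sa A \<beta> c"
    and wandering: "wandering_dynamics Uw Z Sw h \<gamma>0 \<gamma>1"
    and gamma_nonneg: "\<forall>s\<ge>0. 0 \<le> \<gamma>01 s" "\<forall>s\<ge>0. 0 \<le> \<gamma>02 s"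
    and gamma_factor: "\<forall>(x0, z0) \<in> Omega_gamma A h c B1 B2 \<gamma>02 \<Delta>0.
      \<exists>M\<ge>0. (\<forall>i. \<sigma> i \<in> {0..M}) \<and> gain_argument A h c B1 B2 x0 z0 \<in> {0..M} \<and>
        factorizes_on M \<gamma>0 \<gamma>01 \<gamma>02"
    and seq: "\<forall>i. 0 \<le> \<xi> i" "\<forall>i. 0 < \<tau> i"
    and P1: "P1 \<sigma>" and P2: "P2 \<beta> \<xi> \<tau>" and P3: "P3 \<beta> c A h \<sigma> \<xi> \<rho>\<phi> \<rho>\<upsilon> B1 B2"
    and cond1: "\<Delta>0 > 0" "\<forall>i. 1 / \<tau> i * ((\<sigma> i - \<sigma> (Suc i)) / \<gamma>01 (\<sigma> i)) \<ge> \<Delta>0"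
    and cond2: "Omega_gamma A h c B1 B2 \<gamma>02 \<Delta>0 \<noteq> {}"
    and cond3: "filterlim (\<lambda>n. \<Sum>i<n. \<tau> i) at_top sequentially"
    and C1: "generated_by_autonomous_ode (interconnection_trajectory Ua Sa Uw Sw A h)"
    and C2: "practically_iISS Uw Sw \<gamma>1" "continuous_on UNIV h"
    and C3: "steady_state_characteristic Ua Sa A chi"
  shows "\<forall>(x0, z0) \<in> Omega_gamma A h c B1 B2 \<gamma>02 \<Delta>0. \<forall>t0\<ge>0. \<forall>x z.
    interconnection_trajectory Ua Sa Uw Sw A h t0 x z \<and> x t0 = x0 \<and> z t0 = z0 \<longrightarrow>
      converges_to_set (\<lambda>t. (x t, z t)) (Omega_a A h chi)"
proof clarify
  fix t0 :: real and x z
  assume \<Omega>: "(x t0, z t0) \<in> Omega_gamma A h c B1 B2 \<gamma>02 \<Delta>0" and "0 \<le> t0"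
    and traj: "interconnection_trajectory Ua Sa Uw Sw A h t0 x z"
  define a where "a = (\<lambda>t. infdist (x t) A)"
  define y where "y = (\<lambda>t. h (z t))"
  obtain ua uw where ua: "ua \<in> Ua t0" and uw: "uw \<in> Uw t0"
    and loop: "\<And>t. t0 \<le> t \<Longrightarrow> ua t = y t \<and> uw t = a t \<and>
        x t = Sa t0 ua (x t0) t \<and> z t = Sw t0 uw (z t0) t"
    using traj unfolding interconnection_trajectory_def a_def y_def by blast

  have ua_eq: "ua t = y t" and uw_eq: "uw t = a t" and x_eq: "x t = Sa t0 ua (x t0) t"
    and z_eq: "z t = Sw t0 uw (z t0) t" if "t0 \<le> t" for t
    using loop[OF that] by blast+
  have \<beta>: "\<beta> \<in> KL_class" and "0 < c" using contracting by (auto simp: contracting_dynamics_def)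
  have \<gamma>0: "\<gamma>0 \<in> K_class" and \<gamma>1: "\<gamma>1 \<in> K_class"
    using wandering by (auto simp: wandering_dynamics_def K_inf_e_class_def K_inf_class_def)
  have a_nonneg: "0 \<le> a t" for t by (simp add: a_def infdist_nonneg)

  have wander: "(\<lambda>r. \<gamma>1 (a r)) integrable_on {s..t}" "(\<lambda>r. \<gamma>0 (a r)) integrable_on {s..t}"
    "integral {s..t} (\<lambda>r. \<gamma>1 (a r)) \<le> y s - y t" "y s - y t \<le> integral {s..t} (\<lambda>r. \<gamma>0 (a r))"
    if "t0 \<le> s" "s \<le> t" for s t
  proof -
    have cong: "integral {s..t} (\<lambda>r. g (uw r)) = integral {s..t} (\<lambda>r. g (a r))"
      "(\<lambda>r. g (uw r)) integrable_on {s..t} \<longleftrightarrow> (\<lambda>r. g (a r)) integrable_on {s..t}"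
      for g :: "real \<Rightarrow> real"
      using that by (auto intro!: integral_cong integrable_cong simp: uw_eq)
    have yh: "y s = h (Sw t0 uw (z t0) s)" "y t = h (Sw t0 uw (z t0) t)"
      using loop[of s] loop[of t] that by (auto simp: y_def)
    show "(\<lambda>r. \<gamma>1 (a r)) integrable_on {s..t}" "(\<lambda>r. \<gamma>0 (a r)) integrable_on {s..t}"
      "integral {s..t} (\<lambda>r. \<gamma>1 (a r)) \<le> y s - y t" "y s - y t \<le> integral {s..t} (\<lambda>r. \<gamma>0 (a r))"
      using wandering \<open>0 \<le> t0\<close> uw that unfolding wandering_dynamics_def cong[symmetric] yh by auto
  qed
  have y_antimono: "y t \<le> y s" if "t0 \<le> s" "s \<le> t" for s t
  proof -
    have "0 \<le> integral {s..t} (\<lambda>r. \<gamma>1 (a r))"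
      by (intro integral_nonneg wander(1)[OF that] K_class_nonneg[OF \<gamma>1] a_nonneg)
    then show ?thesis using wander(3)[OF that] by linarith
  qed
  have contraction: "a t \<le> \<beta> (a s) (t - s) + c * m"
    if "t0 \<le> s" "s \<le> t" and m: "\<And>r. s \<le> r \<Longrightarrow> r \<le> t \<Longrightarrow> \<bar>y r\<bar> \<le> m" for s t m
  proof -
    have "sup_norm ua s t \<le> m"
      unfolding sup_norm_def using that by (intro cSUP_least) (auto simp: ua_eq)
    moreover have "a t \<le> \<beta> (a s) (t - s) + c * sup_norm ua s t"
    proof -
      have "infdist (Sa t0 ua (x t0) t) A
          \<le> \<beta> (infdist (Sa t0 ua (x t0) s) A) (t - s) + c * sup_norm ua s t"
        using contracting \<open>0 \<le> t0\<close> ua that(1,2) by (simp add: contracting_dynamics_def)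
      then show ?thesis
        using loop[of s] loop[of t] that(1,2) by (simp add: a_def)
    qed
    ultimately show ?thesis
      using \<open>0 < c\<close> by (smt (verit) mult_left_mono)
  qed
  obtain f where "\<forall>t\<ge>t0. ((\<lambda>t. (x t, z t)) has_vector_derivative f (x t, z t)) (at t within {t0..})"
    using C1 \<open>0 \<le> t0\<close> traj unfolding generated_by_autonomous_ode_def by blast
  then have "continuous_on {t0..} (\<lambda>t. (x t, z t))"
    by (intro continuous_on_vector_derivative[where f' = "\<lambda>t. f (x t, z t)"]) simp
  then have "continuous_on {t0..} (\<lambda>t. snd (x t, z t))"
    by (rule continuous_on_snd)
  then have y_cont: "continuous_on {t0..} y"
    unfolding y_def by (intro continuous_on_compose2[OF C2(2)]) auto
  interpret scalar_loop a y \<beta> c \<gamma>0 t0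
    by unfold_locales
      (use \<beta> \<open>0 < c\<close> \<gamma>0 a_nonneg y_cont y_antimono contraction wander in auto)

  define b where "b = gain_argument A h c B1 B2 (x t0) (z t0)"
  obtain M where M: "\<And>i. \<sigma> i \<in> {0..M}" "b \<in> {0..M}" "factorizes_on M \<gamma>0 \<gamma>01 \<gamma>02"
    using gamma_factor \<Omega> unfolding b_def by fast
  have gain_b: "\<gamma>02 b \<le> y t0 * \<Delta>0"
    using \<Omega> by (auto simp: Omega_gamma_def b_def y_def)
  moreover have "0 \<le> \<gamma>02 b" using gamma_nonneg(2) M(2) by simp
  ultimately have y0: "0 \<le> y t0"
    using cond1(1) by (smt (verit) mult_neg_pos)
  have b_eq: "b = B1 (a t0) + B2 (y t0) c + c * y t0"
    using y0 by (simp add: b_def gain_argument_def a_def y_def)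
  have level: "\<tau> i * \<gamma>0 (\<sigma> i * d) \<le> \<gamma>02 d / \<Delta>0 * (\<sigma> i - \<sigma> (Suc i))" if "d \<in> {0..M}" for i d
    by (rule gain_at_level[where \<sigma> = \<sigma> and \<tau> = \<tau>, OF M(3) M(1) that gamma_nonneg cond1(1)])
      (use seq(2) cond1(2) in auto)
  have \<rho>: "admissible_rho \<beta> \<xi> \<rho>\<phi> \<rho>\<upsilon>"
    and B1: "inverse (\<sigma> n) * phi \<beta> \<xi> \<rho>\<phi> n n (a t0) \<le> B1 (a t0)"
    and B2: "inverse (\<sigma> n) * (\<Sum>i=0..n. upsilon \<beta> \<xi> \<rho>\<phi> \<rho>\<upsilon> n i (c * y t0 * \<sigma> (n - i))) \<le> B2 (y t0) c"
    for n
  proof -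
    have yh: "y t0 = \<bar>h (z t0)\<bar>" using y0 by (simp add: y_def)
    show "admissible_rho \<beta> \<xi> \<rho>\<phi> \<rho>\<upsilon>"
      "inverse (\<sigma> n) * phi \<beta> \<xi> \<rho>\<phi> n n (a t0) \<le> B1 (a t0)"
      "inverse (\<sigma> n) * (\<Sum>i=0..n. upsilon \<beta> \<xi> \<rho>\<phi> \<rho>\<upsilon> n i (c * y t0 * \<sigma> (n - i))) \<le> B2 (y t0) c"
      using P3 unfolding P3_def a_def yh by auto
  qed

  have y_nonneg: "0 \<le> y t" if "t0 \<le> t" for t
  proof (cases "y t0 = 0")
    case False
    with y0 have pos: "0 < y t0" by simp
    have L: "\<gamma>02 b / \<Delta>0 \<le> y t0"
      using gain_b cond1(1) by (simp add: field_simps)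
    show ?thesis
      by (rule output_nonneg_of_pos[where \<xi> = \<xi> and \<tau> = \<tau> and \<sigma> = \<sigma> and L = "\<gamma>02 b / \<Delta>0",
            OF pos _ _ P1 P2 \<rho> B1 B2 _ L cond3 that])
        (use seq level[OF M(2)] in \<open>auto simp: b_eq\<close>)
  next
    case True
    \<comment> \<open>here the initial condition forces \<open>\<gamma>02 b = 0\<close>, hence \<open>b = 0\<close>, hence \<open>a t0 = 0\<close>\<close>
    have \<sigma>0: "\<sigma> 0 = 1" using P1 by (simp add: P1_def)
    have "\<gamma>02 b = 0"
      using gain_b True \<open>0 \<le> \<gamma>02 b\<close> by simp
    then have "\<tau> 0 * \<gamma>0 b \<le> 0"
      using level[OF M(2), of 0] \<sigma>0 by simp
    then have "\<gamma>0 b \<le> 0"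
      using seq(2)[rule_format, of 0] by (simp add: mult_le_0_iff)
    then have "b = 0"
      using K_class_pos[OF \<gamma>0, of b] M(2) by (auto simp: less_le)
    moreover have "0 \<le> B2 (y t0) c" "\<beta> (a t0) 0 \<le> B1 (a t0)"
      using B1[of 0] B2[of 0] \<sigma>0 True KL_class_K_class[OF \<beta>]
      by (auto simp: upsilon_def K_class_def)
    ultimately have "\<beta> (a t0) 0 \<le> 0"
      using b_eq True by simp
    then have "a t0 = 0"
      using K_class_pos[OF KL_class_K_class[OF \<beta>], of "a t0"] a_nonneg[of t0] by force
    moreover have "1 \<in> {0..M}" using M(1)[of 0] \<sigma>0 by simp
    ultimately show ?thesis
      by (intro output_nonneg_of_zero[where \<tau> = \<tau> and \<sigma> = \<sigma> and L = "\<gamma>02 1 / \<Delta>0",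
            OF True _ _ P1 _ cond3 that])
        (use level[of 1] seq(2) in auto)
  qed

  have "\<exists>v\<ge>0. (y \<longlongrightarrow> v) at_top"
    by (rule antimono_bounded_converges[where y = y, OF y_antimono y_nonneg])
  then obtain v where "0 \<le> v" and y_lim: "(y \<longlongrightarrow> v) at_top"
    by blast
  have "(ua \<longlongrightarrow> v) at_top"
  proof (rule Lim_transform_eventually[OF y_lim])
    show "\<forall>\<^sub>F t in at_top. y t = ua t"
      using eventually_ge_at_top[of t0] by eventually_elim (simp add: ua_eq)
  qed
  then obtain l where "l \<in> chi v" and Sa_lim: "((\<lambda>t. infdist (Sa t0 ua (x t0) t) A) \<longlongrightarrow> l) at_top"
    using C3 \<open>0 \<le> t0\<close> ua unfolding steady_state_characteristic_def by blast
  have a_lim: "(a \<longlongrightarrow> l) at_top"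
  proof (rule Lim_transform_eventually[OF Sa_lim])
    show "\<forall>\<^sub>F t in at_top. infdist (Sa t0 ua (x t0) t) A = a t"
      using eventually_ge_at_top[of t0]
    proof eventually_elim
      case (elim t)
      then show ?case
        unfolding a_def by (rule arg_cong[where f = "\<lambda>p. infdist p A", OF x_eq, symmetric])
    qed
  qed
  have int_le: "integral {s..t} (\<lambda>r. \<gamma>1 (a r)) \<le> y t0" if "t0 \<le> s" "s \<le> t" for s t
    using wander(3)[OF that] y_nonneg[of t] y_antimono[of t0 s] that by linarith
  have "l = 0"
    by (rule limit_zero_of_bounded_integrals[where \<gamma> = \<gamma>1 and a = a,
          OF \<gamma>1 a_nonneg a_lim wander(1) int_le])

  have "bounded (x ` {t0..})"
  proof -
    have "Sa t0 ua (x t0) \<in> L_inf t0"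
      using sys_a \<open>0 \<le> t0\<close> ua unfolding io_system_def by blast
    moreover have "x ` {t0..} = Sa t0 ua (x t0) ` {t0..}"
      by (rule image_cong[OF refl x_eq]) simp
    ultimately show ?thesis by (simp add: L_inf_def)
  qed
  moreover have "bounded (z ` {t0..})"
  proof -
    have "forward_complete Uw Z Sw"
      using wandering by (simp add: wandering_dynamics_def)
    then have "Sw t0 uw (z t0) \<in> L_inf t0"
      using sys_w \<open>0 \<le> t0\<close> uw unfolding io_system_def forward_complete_def by blast
    moreover have "z ` {t0..} = Sw t0 uw (z t0) ` {t0..}"
      by (rule image_cong[OF refl z_eq]) simp
    ultimately show ?thesis by (simp add: L_inf_def)
  qed
  ultimately have "bounded (x ` {t0..} \<times> z ` {t0..})"
    by (rule bounded_Times)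
  then have bdd: "bounded ((\<lambda>t. (x t, z t)) ` {t0..})"
    by (rule bounded_subset) auto
  show "converges_to_set (\<lambda>t. (x t, z t)) (Omega_a A h chi)"
  proof (rule converges_to_set_of_bounded[OF _ bdd])
    show "continuous_on UNIV (\<lambda>q. (infdist (fst q) A, h (snd q)))"
      by (intro continuous_intros continuous_on_compose2[OF C2(2)]) auto
    show "((\<lambda>t. (infdist (fst (x t, z t)) A, h (snd (x t, z t)))) \<longlongrightarrow> (0, v)) at_top"
      using tendsto_Pair[OF a_lim y_lim] \<open>l = 0\<close> by (simp add: a_def y_def)
    show "q \<in> Omega_a A h chi" if "(infdist (fst q) A, h (snd q)) = (0, v)" for q
      using that \<open>0 \<le> v\<close> \<open>l \<in> chi v\<close> \<open>l = 0\<close> by (cases q) (simp add: Omega_a_def)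
  qed
qed

end
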